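(* Let $\Gamma_1$ and $\Gamma_2$ be finite groups. Then $\Gamma_1 \to \Gamma_2$; that is, there exist a graph $G$ with $|V(G)| \geq 3$ and a vertex $v \in V(G)$ such that $\operatorname{Aut}(G) \cong \Gamma_1$ and $\operatorname{Aut}(G-v) \cong \Gamma_2$.
   Context: All graphs are finite, simple, and undirected, and all groups are finite. $\operatorname{Aut}(G)$ denotes the automorphism group of a graph $G$, and $G-v$ denotes the graph obtained from $G$ by deleting the vertex $v$ together with all edges incident to it. For finite groups $\Gamma_1,\Gamma_2$, one says that $\Gamma_1$ (vertex) deletes to $\Gamma_2$, written $\Gamma_1 \to \Gamma_2$, if there exist a graph $G$ with $|V(G)| \geq 3$ and a vertex $v \in V(G)$ such that $\operatorname{Aut}(G) \cong \Gamma_1$ and $\operatorname{Aut}(G-v) \cong \Gamma_2$. *)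

theory Defs
  imports "HOL-Algebra.Bij" "Graph_Theory.Digraph"
begin

text \<open>
  A finite simple undirected graph is a \<open>pre_digraph\<close> satisfying the locale predicate
  \<^const>\<open>graph\<close>: finite, no loops, no parallel arcs, and symmetric, so that each edge is a
  pair of opposite arcs.  As there are no parallel arcs, an automorphism is determined by its
  action on the vertices.  The group of automorphisms is taken inside \<^const>\<open>BijGroup\<close>, whose
  elements are extensional functions (\<^const>\<open>undefined\<close> outside the vertex set), so that
  every automorphism is counted exactly once.
\<close>

definition graph_auto :: "('v, 'e) pre_digraph \<Rightarrow> ('v \<Rightarrow> 'v) set" where
  "graph_auto G = {f \<in> Bij (verts G). \<forall>x\<in>verts G. \<forall>y\<in>verts G.
     (f x, f y) \<in> arcs_ends G \<longleftrightarrow> (x, y) \<in> arcs_ends G}"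

definition graph_AutoGroup :: "('v, 'e) pre_digraph \<Rightarrow> ('v \<Rightarrow> 'v) monoid" where
  "graph_AutoGroup G = BijGroup (verts G) \<lparr>carrier := graph_auto G\<rparr>"

lemma subgroup_graph_auto: "subgroup (graph_auto G) (BijGroup (verts G))"
proof (rule subgroup.intro)
  show "graph_auto G \<subseteq> carrier (BijGroup (verts G))"
    by (auto simp: graph_auto_def BijGroup_def)
next
  fix f g assume f: "f \<in> graph_auto G" and g: "g \<in> graph_auto G"
  then have "f \<in> Bij (verts G)" and Bg: "g \<in> Bij (verts G)"
    by (auto simp: graph_auto_def)
  moreover have "g x \<in> verts G" if "x \<in> verts G" for x
    using Bij_imp_funcset[OF Bg] that by (rule funcset_mem)
  ultimately show "f \<otimes>\<^bsub>BijGroup (verts G)\<^esub> g \<in> graph_auto G"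
    using f g by (simp add: graph_auto_def BijGroup_def compose_Bij compose_eq)
next
  show "\<one>\<^bsub>BijGroup (verts G)\<^esub> \<in> graph_auto G"
    by (auto simp: graph_auto_def BijGroup_def id_Bij)
next
  fix f assume f: "f \<in> graph_auto G"
  then have B: "f \<in> Bij (verts G)" by (simp add: graph_auto_def)
  let ?h = "inv_into (verts G) f"
  have hf: "f (?h x) = x" if "x \<in> verts G" for x
    using B that by (auto simp: Bij_def bij_betw_def f_inv_into_f)
  have hV: "?h x \<in> verts G" if "x \<in> verts G" for x
    using B that by (rule Bij_inv_into_mem)
  have "(?h x, ?h y) \<in> arcs_ends G \<longleftrightarrow> (x, y) \<in> arcs_ends G"
    if "x \<in> verts G" "y \<in> verts G" for x y
  proof -
    have "(f (?h x), f (?h y)) \<in> arcs_ends G \<longleftrightarrow> (?h x, ?h y) \<in> arcs_ends G"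
      using f hV[OF that(1)] hV[OF that(2)] unfolding graph_auto_def by blast
    then show ?thesis by (simp only: hf that)
  qed
  then show "inv\<^bsub>BijGroup (verts G)\<^esub> f \<in> graph_auto G"
    using B by (simp add: graph_auto_def inv_BijGroup restrict_inv_into_Bij)
qed

lemma group_graph_AutoGroup: "group (graph_AutoGroup G)"
  unfolding graph_AutoGroup_def
  by (rule subgroup.subgroup_is_group[OF subgroup_graph_auto group_BijGroup])

text \<open>
  Since HOL cannot quantify existentially over types, the vertices are taken to be natural
  numbers and the arcs pairs of them; every finite simple graph is isomorphic to one of this form.
\<close>

definition deletes_to :: "('a, 'c) monoid_scheme \<Rightarrow> ('b, 'd) monoid_scheme \<Rightarrow> bool" where
  "deletes_to \<Gamma>\<^sub>1 \<Gamma>\<^sub>2 \<longleftrightarrow>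
     (\<exists>(G :: (nat, nat \<times> nat) pre_digraph) v.
        graph G \<and> card (verts G) \<ge> 3 \<and> v \<in> verts G \<and>
        graph_AutoGroup G \<cong> \<Gamma>\<^sub>1 \<and>
        graph_AutoGroup (pre_digraph.del_vert G v) \<cong> \<Gamma>\<^sub>2)"

end

theory Submission
  imports Defs
begin

text \<open>
  Let \<open>A\<close> and \<open>B\<close> be the two groups.  On the set \<open>A \<times> B\<close>, colour an ordered pair of points as
  follows: points in the same fibre \<open>{a} \<times> B\<close> receive the \<open>B\<close>-quotient of their second
  coordinates, points in different fibres the \<open>A\<close>-quotient of their first coordinates.  The
  bijections preserving this colouring are exactly the maps
  \<open>(a, b) \<mapsto> (\<alpha> a, \<beta> a \<cdot> b)\<close>: one left translation of the set of fibres, and an independent left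
  translation inside each fibre (lemma \<open>marked_aut_is_act\<close>).

  Now mark the point \<open>(a, 1)\<close> in every fibre.  Preserving the marks forces \<open>\<beta> a = 1\<close> for all \<open>a\<close>,
  and what remains is \<open>A\<close>.  If the mark of the fibre over \<open>1\<close> is dropped, that fibre becomes the
  only unmarked one, so \<open>\<alpha> = 1\<close>; and \<open>\<beta> a = 1\<close> is still forced for \<open>a \<noteq> 1\<close>, while \<open>\<beta> 1\<close> is free.
  What remains is \<open>B\<close>.  So it suffices to represent a coloured complete digraph with marked points
  by a graph with the same automorphism group in such a way that a mark is a single vertex, whose
  deletion removes just that mark.

  The graph has vertices \<open>Point i x\<close>, one for each point \<open>x\<close> and each level \<open>i \<in> {1..n}\<close>, and a
  vertex \<open>Point 0 x\<close> for each marked point \<open>x\<close>.  Copies of the same point on different levels are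
  adjacent, except that level \<open>1\<close> is used to record colours: \<open>Point 1 x\<close> is joined to the vertices
  \<open>Point j y\<close> with \<open>j > 1\<close> for which the pair \<open>(x, y)\<close> has colour \<open>j\<close>.  Colour \<open>2\<close> is reserved for the pairs
  \<open>(x, x)\<close>, so the levels from \<open>1\<close> to \<open>n\<close> all have to move in the same way.  A rigid ladder keeps the
  levels apart: the vertices \<open>Rung j\<close> with \<open>j \<le> n + 1\<close> form a clique, \<open>Rung j\<close> is adjacent to all
  points of level less than \<open>j\<close>, and one further vertex \<open>Leaf\<close> hangs from \<open>Rung 0\<close>.  \<open>Leaf\<close> is the only
  vertex of degree one.  Its neighbour is \<open>Rung 0\<close>, whose neighbours other than \<open>Leaf\<close> are the other
  rungs, and these are told apart by the number of points that they see.  Hence an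
  automorphism fixes the ladder, preserves levels and comes from an automorphism of the coloured
  structure (theorem \<open>colour_group_iso_code_group\<close>).
\<close>

section \<open>Automorphisms of coloured complete digraphs\<close>

text \<open>
  Graphs and arc-coloured complete digraphs are handled together: the second argument assigns a
  colour to every ordered pair of points, and for a graph the colours are the two truth values.
\<close>

definition colour_auts :: "'v set \<Rightarrow> ('v \<Rightarrow> 'v \<Rightarrow> 'c) \<Rightarrow> ('v \<Rightarrow> 'v) set" where
  "colour_auts V d = {f \<in> Bij V. \<forall>x\<in>V. \<forall>y\<in>V. d (f x) (f y) = d x y}"

definition colour_group :: "'v set \<Rightarrow> ('v \<Rightarrow> 'v \<Rightarrow> 'c) \<Rightarrow> ('v \<Rightarrow> 'v) monoid" where
  "colour_group V d = BijGroup V \<lparr>carrier := colour_auts V d\<rparr>"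

lemma graph_AutoGroup_eq_colour_group:
  "graph_AutoGroup G = colour_group (verts G) (\<lambda>x y. (x, y) \<in> arcs_ends G)"
  by (simp add: graph_AutoGroup_def graph_auto_def colour_group_def colour_auts_def)

lemma carrier_colour_group [simp]: "carrier (colour_group V d) = colour_auts V d"
  by (simp add: colour_group_def)

lemma colour_autsD:
  assumes "f \<in> colour_auts V d"
  shows "f \<in> extensional V" "bij_betw f V V" "\<And>x. x \<in> V \<Longrightarrow> f x \<in> V"
    "\<And>x y. x \<in> V \<Longrightarrow> y \<in> V \<Longrightarrow> d (f x) (f y) = d x y"
    "\<And>x y. x \<in> V \<Longrightarrow> y \<in> V \<Longrightarrow> f x = f y \<longleftrightarrow> x = y"
    "\<And>y. y \<in> V \<Longrightarrow> \<exists>x\<in>V. f x = y"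
proof -
  show "bij_betw f V V" "f \<in> extensional V"
    "\<And>x y. x \<in> V \<Longrightarrow> y \<in> V \<Longrightarrow> d (f x) (f y) = d x y"
    using assms by (auto simp: colour_auts_def Bij_def)
  then have "inj_on f V" "f ` V = V" by (auto simp: bij_betw_def)
  then show "f x \<in> V" if "x \<in> V" for x using that by blast
  show "\<exists>x\<in>V. f x = y" if "y \<in> V" for y
  proof -
    have "y \<in> f ` V" using that \<open>f ` V = V\<close> by simp
    then show ?thesis by auto
  qed
  show "f x = f y \<longleftrightarrow> x = y" if "x \<in> V" "y \<in> V" for x y
    using that \<open>inj_on f V\<close> by (simp add: inj_on_eq_iff)
qed

lemma colour_autsI:
  assumes "finite V" "f \<in> extensional V" "\<And>x. x \<in> V \<Longrightarrow> f x \<in> V" "inj_on f V"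
    and "\<And>x y. x \<in> V \<Longrightarrow> y \<in> V \<Longrightarrow> d (f x) (f y) = d x y"
  shows "f \<in> colour_auts V d"
proof -
  have "f ` V = V"
    using assms(1,3,4) by (intro endo_inj_surj) auto
  then show ?thesis
    using assms by (auto simp: colour_auts_def Bij_def bij_betw_def)
qed

lemma mult_colour_group:
  "f \<in> colour_auts V d \<Longrightarrow> g \<in> colour_auts V d \<Longrightarrow> f \<otimes>\<^bsub>colour_group V d\<^esub> g = compose V f g"
  by (simp add: colour_group_def BijGroup_def colour_auts_def)

lemma iso_colour_groupI:
  assumes "\<And>g. g \<in> carrier G \<Longrightarrow> \<phi> g \<in> colour_auts V d"
    and "\<And>g h. g \<in> carrier G \<Longrightarrow> h \<in> carrier G \<Longrightarrow> \<phi> (g \<otimes>\<^bsub>G\<^esub> h) = compose V (\<phi> g) (\<phi> h)"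
    and "inj_on \<phi> (carrier G)"
    and "\<And>f. f \<in> colour_auts V d \<Longrightarrow> f \<in> \<phi> ` carrier G"
  shows "G \<cong> colour_group V d"
proof (rule is_isoI, rule isoI)
  show "\<phi> \<in> hom G (colour_group V d)"
    using assms(1,2) by (auto simp: hom_def mult_colour_group)
  show "bij_betw \<phi> (carrier G) (carrier (colour_group V d))"
    using assms(1,3,4) by (auto simp: bij_betw_def)
qed

lemma colour_group_transport:
  assumes h: "bij_betw h V W" and e: "\<And>x y. x \<in> V \<Longrightarrow> y \<in> V \<Longrightarrow> e (h x) (h y) = d x y"
    and fin: "finite V"
  shows "colour_group V d \<cong> colour_group W e"
proof (rule iso_colour_groupI)
  let ?k = "inv_into V h"
  let ?\<phi> = "\<lambda>f. \<lambda>w\<in>W. h (f (?k w))"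
  have k: "?k w \<in> V" "h (?k w) = w" if "w \<in> W" for w
    using h that by (auto simp: bij_betw_def inv_into_into f_inv_into_f)
  have kh: "?k (h x) = x" if "x \<in> V" for x
    using h that by (simp add: bij_betw_def)
  have hW: "h x \<in> W" if "x \<in> V" for x
    using h that by (auto dest: bij_betwE)
  have finW: "finite W"
    using h fin by (simp add: bij_betw_finite)
  show "?\<phi> f \<in> colour_auts W e" if "f \<in> carrier (colour_group V d)" for f
  proof (rule colour_autsI)
    have f: "f \<in> colour_auts V d" using that by simp
    show "?\<phi> f w \<in> W" if "w \<in> W" for w
      using that by (simp add: k hW colour_autsD(3)[OF f])
    show "inj_on (?\<phi> f) W"
    proof (rule inj_onI)
      fix u w assume u: "u \<in> W" and w: "w \<in> W" and "?\<phi> f u = ?\<phi> f w"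
      then have "?k (h (f (?k u))) = ?k (h (f (?k w)))" by simp
      then have "f (?k u) = f (?k w)"
        using u w by (simp add: kh k colour_autsD(3)[OF f])
      then have "?k u = ?k w"
        using u w by (simp add: k colour_autsD(5)[OF f])
      then show "u = w" using k(2) u w by metis
    qed
    show "e (?\<phi> f x) (?\<phi> f y) = e x y" if "x \<in> W" "y \<in> W" for x y
      using that e[of "?k x" "?k y"] by (simp add: k e colour_autsD(3,4)[OF f])
  qed (use finW in auto)
  show "?\<phi> (f \<otimes>\<^bsub>colour_group V d\<^esub> g) = compose W (?\<phi> f) (?\<phi> g)"
    if "f \<in> carrier (colour_group V d)" "g \<in> carrier (colour_group V d)" for f g
  proof -
    have f: "f \<in> colour_auts V d" and g: "g \<in> colour_auts V d" using that by auto
    show ?thesis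
      using colour_autsD(3)[OF g]
      by (auto simp: mult_colour_group[OF f g] compose_def k hW kh intro!: restrict_ext)
  qed
  show "inj_on ?\<phi> (carrier (colour_group V d))"
  proof (rule inj_onI)
    fix f g assume "f \<in> carrier (colour_group V d)" "g \<in> carrier (colour_group V d)"
      and eq: "?\<phi> f = ?\<phi> g"
    then have f: "f \<in> colour_auts V d" and g: "g \<in> colour_auts V d" by auto
    show "f = g"
    proof (rule extensionalityI[OF colour_autsD(1)[OF f] colour_autsD(1)[OF g]])
      fix x assume x: "x \<in> V"
      then have "?k (h (f x)) = ?k (h (g x))"
        using fun_cong[OF eq, of "h x"] by (simp add: hW kh)
      then show "f x = g x"
        using x by (simp add: kh colour_autsD(3)[OF f] colour_autsD(3)[OF g])
    qed
  qed
  show "f \<in> ?\<phi> ` carrier (colour_group V d)" if f: "f \<in> colour_auts W e" for f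
  proof (rule image_eqI)
    let ?g = "\<lambda>x\<in>V. ?k (f (h x))"
    show "?g \<in> carrier (colour_group V d)"
      unfolding carrier_colour_group
    proof (rule colour_autsI)
      show "?g x \<in> V" if "x \<in> V" for x
        using that by (simp add: k hW colour_autsD(3)[OF f])
      show "inj_on ?g V"
      proof (rule inj_onI)
        fix x y assume x: "x \<in> V" and y: "y \<in> V" and "?g x = ?g y"
        then have "h (?k (f (h x))) = h (?k (f (h y)))" by simp
        then have "h x = h y"
          using x y by (simp add: k hW colour_autsD(3,5)[OF f])
        then show "x = y" using kh x y by metis
      qed
      show "d (?g x) (?g y) = d x y" if "x \<in> V" "y \<in> V" for x y
        using that e[of "?k (f (h x))" "?k (f (h y))"]
        by (simp add: k hW e colour_autsD(3,4)[OF f])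
    qed (use fin in auto)
    show "f = ?\<phi> ?g"
      by (rule extensionalityI[OF colour_autsD(1)[OF f]])
        (auto simp: k hW colour_autsD(3)[OF f])
  qed
qed

text \<open>
  The vertices of a graph built over an arbitrary type can be renamed injectively to natural
  numbers; this turns a relation on such a type into a witness for \<^const>\<open>deletes_to\<close>.
\<close>

lemma deletes_toI:
  assumes fin: "finite V" and card: "card V \<ge> 3" and v: "v \<in> V"
    and sym: "\<And>x y. E x y \<Longrightarrow> E y x" and irr: "\<And>x. \<not> E x x"
    and grp: "group \<Gamma>\<^sub>1" "group \<Gamma>\<^sub>2"
    and iso: "\<Gamma>\<^sub>1 \<cong> colour_group V E" "\<Gamma>\<^sub>2 \<cong> colour_group (V - {v}) E"
  shows "deletes_to \<Gamma>\<^sub>1 \<Gamma>\<^sub>2"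
proof -
  obtain h :: "'a \<Rightarrow> nat" where h: "inj_on h V"
    using finite_imp_inj_to_nat_seg[OF fin] by blast
  define A where "A = {(h x, h y) | x y. x \<in> V \<and> y \<in> V \<and> E x y}"
  define G where "G = \<lparr>verts = h ` V, arcs = A, tail = fst, head = snd\<rparr>"
  have A: "(h x, h y) \<in> A \<longleftrightarrow> E x y" if "x \<in> V" "y \<in> V" for x y
    using that h by (auto simp: A_def dest: inj_onD)
  have sub: "A \<subseteq> h ` V \<times> h ` V" by (auto simp: A_def)
  have "finite A" by (rule finite_subset[OF sub]) (use fin in auto)
  have ends: "arcs_ends G = A"
    by (auto simp: arcs_ends_conv G_def)
  have "graph G"
  proof unfold_locales
    show "symmetric G"
      unfolding symmetric_def ends using sym by (auto simp: A_def sym_def)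
  next
    fix e assume "e \<in> arcs G"
    then obtain x y where xy: "e = (h x, h y)" "x \<in> V" "y \<in> V" "E x y"
      by (auto simp: G_def A_def)
    then have "x \<noteq> y" using irr by metis
    then show "tail G e \<noteq> head G e"
      using xy h by (auto simp: G_def dest: inj_onD)
  qed (use sub fin \<open>finite A\<close> in \<open>auto simp: G_def arc_to_ends_def\<close>)
  moreover have "card (verts G) \<ge> 3"
    using card h by (simp add: G_def card_image)
  moreover have "h v \<in> verts G" using v by (simp add: G_def)
  moreover have "graph_AutoGroup G \<cong> \<Gamma>\<^sub>1"
  proof -
    have "colour_group V E \<cong> graph_AutoGroup G"
      unfolding graph_AutoGroup_eq_colour_group ends
      by (rule colour_group_transport[OF _ _ fin]) (use h A in \<open>auto simp: G_def bij_betw_def\<close>)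
    then show ?thesis
      using iso(1) grp(1) by (blast intro: iso_trans group.iso_sym)
  qed
  moreover have "graph_AutoGroup (pre_digraph.del_vert G (h v)) \<cong> \<Gamma>\<^sub>2"
  proof -
    let ?G' = "pre_digraph.del_vert G (h v)"
    have ends': "arcs_ends ?G' = {(a, b) \<in> A. a \<noteq> h v \<and> b \<noteq> h v}"
      by (auto simp: arcs_ends_conv pre_digraph.del_vert_def G_def image_iff)
    have "bij_betw h (V - {v}) (verts ?G')"
      using h v by (auto simp: bij_betw_def pre_digraph.del_vert_def G_def inj_on_def)
    then have "colour_group (V - {v}) E \<cong> graph_AutoGroup ?G'"
      unfolding graph_AutoGroup_eq_colour_group
      by (rule colour_group_transport)
        (use h v A fin in \<open>auto simp: ends' dest: inj_onD\<close>)
    then show ?thesis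
      using iso(2) grp(2) by (blast intro: iso_trans group.iso_sym)
  qed
  ultimately show ?thesis unfolding deletes_to_def by blast
qed

section \<open>Encoding a coloured complete digraph with marked points as a graph\<close>

datatype 'x vertex = Leaf | Rung nat | Point nat 'x

text \<open>
  Half of the adjacency between points, from the lower to the higher level.  Level \<open>1\<close> looks up the
  colour of a pair; every other level looks only for equality of points.
\<close>

definition link :: "('x \<Rightarrow> 'x \<Rightarrow> nat) \<Rightarrow> nat \<Rightarrow> 'x \<Rightarrow> nat \<Rightarrow> 'x \<Rightarrow> bool" where
  "link d i x j y \<longleftrightarrow> i < j \<and> (if i = 1 then d x y = j else x = y)"

fun adj :: "('x \<Rightarrow> 'x \<Rightarrow> nat) \<Rightarrow> 'x vertex \<Rightarrow> 'x vertex \<Rightarrow> bool" where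
  "adj d Leaf v \<longleftrightarrow> v = Rung 0"
| "adj d (Rung i) v \<longleftrightarrow> (case v of Leaf \<Rightarrow> i = 0 | Rung j \<Rightarrow> i \<noteq> j | Point j y \<Rightarrow> j < i)"
| "adj d (Point i x) v \<longleftrightarrow>
     (case v of Leaf \<Rightarrow> False | Rung j \<Rightarrow> i < j | Point j y \<Rightarrow> link d i x j y \<or> link d j y i x)"

lemma adj_sym: "adj d u v \<Longrightarrow> adj d v u"
  by (cases u; cases v) auto

lemma adj_irrefl: "\<not> adj d v v"
  by (cases v) (auto simp: link_def)

definition code_verts :: "nat \<Rightarrow> 'x set \<Rightarrow> 'x set \<Rightarrow> 'x vertex set" where
  "code_verts n X P =
     insert Leaf (Rung ` {..n + 1}) \<union> {Point i x | i x. i \<le> n \<and> x \<in> X \<and> (i = 0 \<longrightarrow> x \<in> P)}"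

lemma code_verts_simps [simp]:
  "Leaf \<in> code_verts n X P"
  "Rung j \<in> code_verts n X P \<longleftrightarrow> j \<le> n + 1"
  "Point i x \<in> code_verts n X P \<longleftrightarrow> i \<le> n \<and> x \<in> X \<and> (i = 0 \<longrightarrow> x \<in> P)"
  by (auto simp: code_verts_def)

lemma finite_code_verts: "finite X \<Longrightarrow> finite (code_verts n X P)"
proof -
  assume "finite X"
  then have "finite ((\<lambda>(i, x). Point i x) ` ({..n} \<times> X))" by simp
  moreover have "{Point i x | i x. i \<le> n \<and> x \<in> X \<and> (i = 0 \<longrightarrow> x \<in> P)}
      \<subseteq> (\<lambda>(i, x). Point i x) ` ({..n} \<times> X)" by auto
  ultimately show ?thesis
    unfolding code_verts_def using finite_subset by fastforce
qed

text \<open>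
  The colours are required to be the numbers of levels above level \<open>1\<close>.  Colour \<open>2\<close> on the diagonal
  identifies level \<open>1\<close> with level \<open>2\<close>, and with it all levels.  The bound \<open>3 \<le> n\<close> provides a point of
  level \<open>n\<close> with a second neighbour besides the top rung.
\<close>

locale encoding =
  fixes X P :: "'x set" and d :: "'x \<Rightarrow> 'x \<Rightarrow> nat" and n :: nat
  assumes finX: "finite X" and neX: "X \<noteq> {}" and PX: "P \<subseteq> X" and n: "3 \<le> n"
    and d_range: "x \<in> X \<Longrightarrow> y \<in> X \<Longrightarrow> d x y \<in> {2..n}"
    and d_diag: "x \<in> X \<Longrightarrow> y \<in> X \<Longrightarrow> d x y = 2 \<longleftrightarrow> x = y"
begin

abbreviation V where "V \<equiv> code_verts n X P"

text \<open>
  \<open>Leaf\<close> is recognised by its degree: a rung has two other rungs as neighbours, a point below level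
  \<open>n\<close> is adjacent to the two top rungs, and a point of level \<open>n\<close> to the top rung and to its own copy on
  level \<open>2\<close>.
\<close>

lemma neighbour_unique_imp_Leaf:
  assumes u: "u \<in> V" and uniq: "\<And>w w'. w \<in> V \<Longrightarrow> w' \<in> V \<Longrightarrow> adj d u w \<Longrightarrow> adj d u w' \<Longrightarrow> w = w'"
  shows "u = Leaf"
proof (cases u)
  case (Rung i)
  then show ?thesis
    using uniq[of "Rung 0" "Rung 1"] uniq[of "Rung 0" "Rung 2"] uniq[of "Rung 1" "Rung 2"] n
    by simp presburger
next
  case (Point i x)
  show ?thesis
  proof (cases "i = n")
    case True
    then show ?thesis
      using u Point uniq[of "Rung (n + 1)" "Point 2 x"] n by (auto simp: link_def)
  next
    case False
    then show ?thesis
      using u Point uniq[of "Rung (n + 1)" "Rung n"] n by auto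
  qed
qed

definition below :: "nat \<Rightarrow> 'x vertex set" where
  "below j = {v \<in> V. \<exists>i x. v = Point i x \<and> i < j}"

text \<open>
  The case \<open>j = 0\<close> has to be left out: the level separating \<open>Rung 0\<close> from \<open>Rung 1\<close> is that of the marks,
  which may be empty.
\<close>

lemma card_below_mono:
  assumes "1 \<le> j" "j < k" "k \<le> n + 1"
  shows "card (below j) < card (below k)"
proof (rule psubset_card_mono)
  show "finite (below k)"
    using finite_code_verts[OF finX] by (simp add: below_def)
  obtain x where "x \<in> X" using neX by blast
  then have "Point j x \<in> below k - below j" using assms by (auto simp: below_def)
  moreover have "below j \<subseteq> below k" using assms by (auto simp: below_def)
  ultimately show "below j \<subset> below k" by blast
qed

context
  fixes f assumes f: "f \<in> colour_auts V (adj d)"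
begin

lemmas f_props = colour_autsD[OF f]

text \<open>
  The following lemmas determine an arbitrary automorphism \<open>f\<close> of the graph, starting from \<open>Leaf\<close> and
  working through the rungs to the points.
\<close>

lemma aut_Leaf: "f Leaf = Leaf"
proof (rule neighbour_unique_imp_Leaf)
  show "f Leaf \<in> V" by (simp add: f_props)
next
  fix w w' assume w: "w \<in> V" "w' \<in> V" "adj d (f Leaf) w" "adj d (f Leaf) w'"
  then obtain u u' where "u \<in> V" "f u = w" "u' \<in> V" "f u' = w'" using f_props(6) by meson
  then show "w = w'" using w f_props(4)[of Leaf u] f_props(4)[of Leaf u'] by auto
qed

lemma aut_Rung0: "f (Rung 0) = Rung 0"
  using f_props(4)[of Leaf "Rung 0"] by (simp add: aut_Leaf)

text \<open>
  Apart from \<open>Leaf\<close>, exactly the rungs are adjacent or equal to \<open>Rung 0\<close>, so rungs go to rungs and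
  points to points.
\<close>

lemma aut_Rung_Rung: assumes "j \<le> n + 1" obtains k where "f (Rung j) = Rung k"
proof (cases "j = 0")
  case False
  then have "adj d (Rung 0) (f (Rung j))"
    using f_props(4)[of "Rung 0" "Rung j"] assms by (simp add: aut_Rung0)
  moreover have "f (Rung j) \<noteq> Leaf"
    using f_props(5)[of "Rung j" Leaf] assms by (simp add: aut_Leaf)
  ultimately show ?thesis using that by (cases "f (Rung j)") auto
qed (use aut_Rung0 that in auto)

lemma aut_Point_Point:
  assumes "Point i x \<in> V" obtains k y where "f (Point i x) = Point k y"
proof (cases "f (Point i x)")
  case Leaf
  then show ?thesis using f_props(5)[OF assms, of Leaf] by (simp add: aut_Leaf)
next
  case (Rung j)
  then have "adj d (Rung 0) (f (Point i x)) \<or> f (Point i x) = f (Rung 0)"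
    by (auto simp: aut_Rung0)
  then show ?thesis
    using f_props(4)[of "Rung 0", OF _ assms] f_props(5)[OF assms, of "Rung 0"]
    by (auto simp: aut_Rung0)
qed

text \<open>
  If \<open>f\<close> takes \<open>Rung j\<close> to \<open>Rung k\<close>, it maps the points below level \<open>j\<close> bijectively to those below
  level \<open>k\<close>, and the sizes of these two sets show \<open>k = j\<close>.
\<close>

lemma aut_Rung: assumes j: "j \<le> n + 1" shows "f (Rung j) = Rung j"
proof (cases "j = 0")
  case False
  obtain k where k: "f (Rung j) = Rung k" using aut_Rung_Rung j .
  have "k \<le> n + 1" using f_props(3)[of "Rung j"] j k by simp
  have "k \<noteq> 0"
    using f_props(5)[of "Rung j" "Rung 0"] j k False by (auto simp: aut_Rung0)
  have iff: "f v \<in> below k \<longleftrightarrow> v \<in> below j" if v: "v \<in> V" for v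
  proof (cases v)
    case Leaf then show ?thesis by (simp add: aut_Leaf below_def)
  next
    case (Rung i)
    obtain k' where "f (Rung i) = Rung k'"
      by (rule aut_Rung_Rung[of i]) (use Rung v in auto)
    then show ?thesis using Rung by (simp add: below_def)
  next
    case (Point i x)
    obtain i' y where "f (Point i x) = Point i' y"
      by (rule aut_Point_Point[of i x]) (use Point v in auto)
    then show ?thesis
      using Point v j f_props(3)[OF v] f_props(4)[of "Rung j", OF _ v] k by (auto simp: below_def)
  qed
  have "f ` below j = below k"
  proof
    have "below j \<subseteq> V" by (auto simp: below_def)
    then show "f ` below j \<subseteq> below k" using iff by blast
    show "below k \<subseteq> f ` below j"
    proof
      fix w assume w: "w \<in> below k"
      then obtain v where "v \<in> V" "f v = w" using f_props(6)[of w] by (auto simp: below_def)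
      then show "w \<in> f ` below j" using iff w by blast
    qed
  qed
  moreover have "inj_on f (below j)"
    using f_props(2) by (rule bij_betw_imp_inj_on[THEN inj_on_subset]) (auto simp: below_def)
  ultimately have "card (below k) = card (below j)" using card_image by metis
  then have "k = j"
    using card_below_mono[of j k] card_below_mono[of k j] j \<open>k \<le> n + 1\<close> \<open>k \<noteq> 0\<close> False
    by (cases j k rule: linorder_cases) auto
  then show ?thesis using k by simp
qed (simp add: aut_Rung0)

lemma aut_level:
  assumes v: "Point i x \<in> V" obtains y where "f (Point i x) = Point i y" "Point i y \<in> V"
proof -
  obtain k y where ky: "f (Point i x) = Point k y" using aut_Point_Point[OF v] .
  then have kV: "Point k y \<in> V" using f_props(3)[OF v] by simp
  have "k < j \<longleftrightarrow> i < j" if "j \<le> n + 1" for j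
    using f_props(4)[of "Rung j", OF _ v] that ky by (simp add: aut_Rung)
  from this[of i] this[of k] have "k = i" using v kV by (cases i k rule: linorder_cases) auto
  then show ?thesis using that ky kV by simp
qed

text \<open>
  The permutation of \<open>X\<close> that \<open>f\<close> induces on level \<open>1\<close>, and, as is shown next, on every other level.
\<close>

definition base :: "'x \<Rightarrow> 'x" where
  "base = (\<lambda>x\<in>X. THE y. f (Point 1 x) = Point 1 y)"

lemma aut_Point1: assumes "x \<in> X" shows "f (Point 1 x) = Point 1 (base x)" "base x \<in> X"
proof -
  obtain y where y: "f (Point 1 x) = Point 1 y" "Point 1 y \<in> V"
    by (rule aut_level[of 1 x]) (use assms n in auto)
  then have "base x = y" using assms by (simp add: base_def)
  then show "f (Point 1 x) = Point 1 (base x)" "base x \<in> X" using y by auto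
qed

lemma aut_Point2: assumes "x \<in> X" shows "f (Point 2 x) = Point 2 (base x)"
proof -
  obtain y where y: "f (Point 2 x) = Point 2 y" "Point 2 y \<in> V"
    by (rule aut_level[of 2 x]) (use assms n in auto)
  have "adj d (f (Point 1 x)) (f (Point 2 x)) = adj d (Point 1 x) (Point 2 x)"
    using assms n by (intro f_props(4)) auto
  then have "d (base x) y = 2"
    using y assms d_diag[of x x] by (simp only: aut_Point1) (simp add: link_def)
  then show ?thesis using y d_diag[of "base x" y] aut_Point1[OF assms] by simp
qed

text \<open>
  Levels other than \<open>1\<close> and \<open>2\<close>, that of the marks included, follow level \<open>2\<close>, because \<open>Point 2 x\<close> is
  adjacent to exactly one vertex of such a level if it is adjacent to any: the copy of \<open>x\<close>.
\<close>

lemma aut_Point: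
  assumes v: "Point i x \<in> V" shows "f (Point i x) = Point i (base x)"
proof (cases "i = 1 \<or> i = 2")
  case True
  then show ?thesis using v aut_Point1 aut_Point2 by auto
next
  case False
  obtain y where y: "f (Point i x) = Point i y" using aut_level[OF v] .
  have "adj d (f (Point 2 x)) (f (Point i x)) = adj d (Point 2 x) (Point i x)"
    using v n by (intro f_props(4)) auto
  then show ?thesis using y v False by (auto simp: aut_Point2 link_def)
qed

lemma base_mem_colour_auts: "base \<in> colour_auts X (\<lambda>x y. (d x y, x \<in> P))"
proof (rule colour_autsI)
  show "finite X" by (rule finX)
  show "base \<in> extensional X" by (simp add: base_def)
  show "base x \<in> X" if "x \<in> X" for x using that by (rule aut_Point1)
  show "inj_on base X"
  proof (rule inj_onI)
    fix x y assume xy: "x \<in> X" "y \<in> X" "base x = base y"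
    then have "f (Point 1 x) = f (Point 1 y)" by (simp only: aut_Point1)
    then show "x = y" using f_props(5)[of "Point 1 x" "Point 1 y"] xy n by simp
  qed
  show "(d (base x) (base y), base x \<in> P) = (d x y, x \<in> P)" if x: "x \<in> X" and y: "y \<in> X" for x y
  proof -
    define j where "j = d x y"
    have j: "2 \<le> j" "j \<le> n" using d_range[OF x y] by (auto simp: j_def)
    have "adj d (f (Point 1 x)) (f (Point j y)) = adj d (Point 1 x) (Point j y)"
      using x y n j by (intro f_props(4)) auto
    then have 1: "d (base x) (base y) = d x y"
      using x y j aut_Point[of 1 x] aut_Point[of j y] n by (auto simp: link_def j_def)
    have 2: "base x \<in> P" if "x \<in> P"
      using aut_Point[of 0 x] f_props(3)[of "Point 0 x"] that x by auto
    \<comment> \<open>The mark on the image has a preimage, which is a mark sitting on \<open>x\<close>.\<close>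
    have 3: "x \<in> P" if b: "base x \<in> P"
    proof -
      have "Point 0 (base x) \<in> V" using b PX by auto
      then obtain v where v: "v \<in> V" "f v = Point 0 (base x)" using f_props(6) by blast
      show ?thesis
      proof (cases v)
        case Leaf then show ?thesis using v by (simp add: aut_Leaf)
      next
        case (Rung i) then show ?thesis using v by (simp add: aut_Rung)
      next
        case (Point i z)
        then have *: "i = 0" "base z = base x" "z \<in> P" "z \<in> X" using v aut_Point[of i z] by auto
        then have "f (Point 1 z) = f (Point 1 x)" using x by (simp only: aut_Point1)
        then show ?thesis using f_props(5)[of "Point 1 z" "Point 1 x"] * x n by simp
      qed
    qed
    show ?thesis using 1 2 3 by auto
  qed
qed

lemma aut_eq_map_base: "f = restrict (map_vertex base) V"
proof (rule extensionalityI[OF f_props(1)])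
  fix v assume v: "v \<in> V"
  then show "f v = restrict (map_vertex base) V v"
    by (cases v) (auto simp: aut_Leaf aut_Rung aut_Point)
qed simp

end

theorem colour_group_iso_code_group:
  "colour_group X (\<lambda>x y. (d x y, x \<in> P)) \<cong> colour_group V (adj d)"
proof (rule iso_colour_groupI)
  let ?D = "\<lambda>x y. (d x y, x \<in> P)"
  let ?\<phi> = "\<lambda>p. restrict (map_vertex p) V"
  have V: "map_vertex p v \<in> V" if p: "p \<in> colour_auts X ?D" and v: "v \<in> V" for p v
    using v colour_autsD(3)[OF p] colour_autsD(4)[OF p] by (cases v) auto
  show "?\<phi> p \<in> colour_auts V (adj d)" if "p \<in> carrier (colour_group X ?D)" for p
  proof (rule colour_autsI)
    have p: "p \<in> colour_auts X ?D" using that by simp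
    note pp = colour_autsD[OF p]
    show "finite V" by (rule finite_code_verts[OF finX])
    show "?\<phi> p v \<in> V" if "v \<in> V" for v using V[OF p that] that by simp
    show "inj_on (?\<phi> p) V"
    proof (rule inj_onI)
      fix u v assume "u \<in> V" "v \<in> V" "?\<phi> p u = ?\<phi> p v"
      then show "u = v" by (cases u; cases v) (auto simp: pp)
    qed
    show "adj d (?\<phi> p u) (?\<phi> p v) = adj d u v" if "u \<in> V" "v \<in> V" for u v
    proof -
      have "d (p x) (p y) = d x y" if "x \<in> X" "y \<in> X" for x y
        using pp(4)[OF that] by simp
      then show ?thesis
        using that by (cases u; cases v) (auto simp: link_def pp(3,5))
    qed
  qed simp
  show "?\<phi> (p \<otimes>\<^bsub>colour_group X ?D\<^esub> q) = compose V (?\<phi> p) (?\<phi> q)"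
    if "p \<in> carrier (colour_group X ?D)" "q \<in> carrier (colour_group X ?D)" for p q
  proof
    fix v
    have p: "p \<in> colour_auts X ?D" and q: "q \<in> colour_auts X ?D" using that by auto
    show "?\<phi> (p \<otimes>\<^bsub>colour_group X ?D\<^esub> q) v = compose V (?\<phi> p) (?\<phi> q) v"
      using V[OF q, of v]
      by (cases v) (auto simp: mult_colour_group[OF p q] compose_def)
  qed
  show "inj_on ?\<phi> (carrier (colour_group X ?D))"
  proof (rule inj_onI)
    fix p q assume "p \<in> carrier (colour_group X ?D)" "q \<in> carrier (colour_group X ?D)"
      and eq: "?\<phi> p = ?\<phi> q"
    then have p: "p \<in> colour_auts X ?D" and q: "q \<in> colour_auts X ?D" by auto
    show "p = q"
    proof (rule extensionalityI[OF colour_autsD(1)[OF p] colour_autsD(1)[OF q]])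
      fix x assume "x \<in> X"
      then show "p x = q x" using fun_cong[OF eq, of "Point 1 x"] n by simp
    qed
  qed
  show "f \<in> ?\<phi> ` carrier (colour_group X ?D)" if "f \<in> colour_auts V (adj d)" for f
    using aut_eq_map_base[OF that] base_mem_colour_auts[OF that] by auto
qed

end


section \<open>A coloured digraph carrying two groups\<close>

lemma (in group) inv_mult_translate:
  assumes "c \<in> carrier G" "x \<in> carrier G" "y \<in> carrier G"
  shows "inv (c \<otimes> x) \<otimes> (c \<otimes> y) = inv x \<otimes> y"
proof -
  have "inv c \<otimes> (c \<otimes> y) = y" using assms by (simp add: m_assoc[symmetric])
  then show ?thesis using assms by (simp add: inv_mult_group m_assoc)
qed

text \<open>
  Throughout, \<open>A\<close> permutes the fibres \<open>{a} \<times> B\<close> of \<open>A \<times> B\<close>, and \<open>B\<close> acts inside a fibre.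
\<close>

locale group_pair = A: group A + B: group B
  for A :: "('a, 'c) monoid_scheme" and B :: "('b, 'd) monoid_scheme" +
  assumes finA: "finite (carrier A)" and finB: "finite (carrier B)"
begin

definition X :: "('a \<times> 'b) set" where
  "X = carrier A \<times> carrier B"

text \<open>
  Within a fibre, a Cayley colouring of \<open>B\<close>; between fibres, the Cayley colouring of \<open>A\<close>, blind to the
  second coordinate so that different fibres can be translated independently.
\<close>

definition D :: "'a \<times> 'b \<Rightarrow> 'a \<times> 'b \<Rightarrow> 'a + 'b" where
  "D x y = (if fst x = fst y then Inr (inv\<^bsub>B\<^esub> (snd x) \<otimes>\<^bsub>B\<^esub> snd y)
            else Inl (inv\<^bsub>A\<^esub> (fst x) \<otimes>\<^bsub>A\<^esub> fst y))"

definition act :: "'a \<Rightarrow> ('a \<Rightarrow> 'b) \<Rightarrow> 'a \<times> 'b \<Rightarrow> 'a \<times> 'b" where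
  "act \<alpha> \<beta> = (\<lambda>x\<in>X. (\<alpha> \<otimes>\<^bsub>A\<^esub> fst x, \<beta> (fst x) \<otimes>\<^bsub>B\<^esub> snd x))"

abbreviation marked :: "'a set \<Rightarrow> ('a \<times> 'b) set" where
  "marked Q \<equiv> Q \<times> {\<one>\<^bsub>B\<^esub>}"

abbreviation marked_auts :: "'a set \<Rightarrow> ('a \<times> 'b \<Rightarrow> 'a \<times> 'b) set" where
  "marked_auts Q \<equiv> colour_auts X (\<lambda>x y. (D x y, x \<in> marked Q))"

lemma finX: "finite X"
  by (simp add: X_def finA finB)

lemma D_diag:
  assumes "x \<in> X" "y \<in> X" shows "D x y = Inr \<one>\<^bsub>B\<^esub> \<longleftrightarrow> x = y"
proof -
  have "inv\<^bsub>B\<^esub> (snd x) \<otimes>\<^bsub>B\<^esub> snd y = \<one>\<^bsub>B\<^esub> \<longleftrightarrow> snd x = snd y"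
    using assms B.inv_solve_left[of "\<one>\<^bsub>B\<^esub>" "snd x" "snd y"] by (auto simp: X_def)
  then show ?thesis by (auto simp: D_def prod_eq_iff)
qed

lemma D_act:
  assumes "\<alpha> \<in> carrier A" "\<And>a. a \<in> carrier A \<Longrightarrow> \<beta> a \<in> carrier B" "x \<in> X" "y \<in> X"
  shows "D (act \<alpha> \<beta> x) (act \<alpha> \<beta> y) = D x y"
proof -
  show ?thesis
    using assms by (auto simp: act_def D_def X_def A.inv_mult_translate B.inv_mult_translate)
qed

lemma act_mem_marked_auts:
  assumes \<alpha>: "\<alpha> \<in> carrier A" and \<beta>: "\<And>a. a \<in> carrier A \<Longrightarrow> \<beta> a \<in> carrier B"
    and marks: "\<And>a b. a \<in> carrier A \<Longrightarrow> b \<in> carrier B \<Longrightarrow>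
      (\<alpha> \<otimes>\<^bsub>A\<^esub> a \<in> Q \<and> \<beta> a \<otimes>\<^bsub>B\<^esub> b = \<one>\<^bsub>B\<^esub>) \<longleftrightarrow> (a \<in> Q \<and> b = \<one>\<^bsub>B\<^esub>)"
  shows "act \<alpha> \<beta> \<in> marked_auts Q"
proof (rule colour_autsI[OF finX])
  show act_X: "act \<alpha> \<beta> x \<in> X" if "x \<in> X" for x
    using that \<alpha> \<beta> by (auto simp: act_def X_def)
  show "inj_on (act \<alpha> \<beta>) X"
  proof (rule inj_onI)
    fix x y assume x: "x \<in> X" and y: "y \<in> X" and "act \<alpha> \<beta> x = act \<alpha> \<beta> y"
    then have "D (act \<alpha> \<beta> x) (act \<alpha> \<beta> y) = Inr \<one>\<^bsub>B\<^esub>" using act_X D_diag by simp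
    then show "x = y" using D_act[OF \<alpha> \<beta> x y] D_diag[OF x y] by simp
  qed
  show "(D (act \<alpha> \<beta> x) (act \<alpha> \<beta> y), act \<alpha> \<beta> x \<in> marked Q) = (D x y, x \<in> marked Q)"
    if "x \<in> X" "y \<in> X" for x y
  proof -
    have "D (act \<alpha> \<beta> x) (act \<alpha> \<beta> y) = D x y"
      using \<alpha> \<beta> that by (rule D_act)
    moreover have "act \<alpha> \<beta> x \<in> marked Q \<longleftrightarrow> x \<in> marked Q"
      using marks[of "fst x" "snd x"] that(1) by (simp add: act_def X_def mem_Times_iff)
    ultimately show ?thesis by simp
  qed
qed (simp add: act_def)

lemma compose_act:
  assumes "\<alpha> \<in> carrier A" "\<alpha>' \<in> carrier A"
    and "\<And>a. a \<in> carrier A \<Longrightarrow> \<beta> a \<in> carrier B" "\<And>a. a \<in> carrier A \<Longrightarrow> \<beta>' a \<in> carrier B"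
  shows "compose X (act \<alpha> \<beta>) (act \<alpha>' \<beta>') =
    act (\<alpha> \<otimes>\<^bsub>A\<^esub> \<alpha>') (\<lambda>a. \<beta> (\<alpha>' \<otimes>\<^bsub>A\<^esub> a) \<otimes>\<^bsub>B\<^esub> \<beta>' a)"
  unfolding compose_def act_def
  by (rule restrict_ext) (use assms in \<open>auto simp: X_def A.m_assoc B.m_assoc\<close>)

lemma act_cong:
  "\<alpha> = \<alpha>' \<Longrightarrow> (\<And>a. a \<in> carrier A \<Longrightarrow> \<beta> a = \<beta>' a) \<Longrightarrow> act \<alpha> \<beta> = act \<alpha>' \<beta>'"
  unfolding act_def by (rule restrict_ext) (auto simp: X_def)

text \<open>
  Every colour-preserving map has this shape.  Inside the fibre over \<open>a\<close>, the colour of the pair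
  \<open>(a, 1), (a, b)\<close> is \<open>b\<close>, so the image of \<open>(a, b)\<close> is determined by that of \<open>(a, 1)\<close> and lies in the same
  fibre as that.  The colour of \<open>(1, 1), (a, 1)\<close> is \<open>a\<close>, so the image of the fibre over \<open>1\<close> determines
  the images of all the others.  Applied to \<open>(a, 1)\<close>, preservation of the marks is the last property.
\<close>

lemma marked_aut_is_act:
  assumes f: "f \<in> marked_auts Q"
  obtains \<alpha> \<beta> where "\<alpha> \<in> carrier A" "\<And>a. a \<in> carrier A \<Longrightarrow> \<beta> a \<in> carrier B" "f = act \<alpha> \<beta>"
    "\<And>a. a \<in> carrier A \<Longrightarrow> \<alpha> \<otimes>\<^bsub>A\<^esub> a \<in> Q \<and> \<beta> a = \<one>\<^bsub>B\<^esub> \<longleftrightarrow> a \<in> Q"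
proof -
  define \<alpha> where "\<alpha> = fst (f (\<one>\<^bsub>A\<^esub>, \<one>\<^bsub>B\<^esub>))"
  define \<beta> where "\<beta> a = snd (f (a, \<one>\<^bsub>B\<^esub>))" for a
  have fX: "fst (f (a, b)) \<in> carrier A" "snd (f (a, b)) \<in> carrier B"
    if "a \<in> carrier A" "b \<in> carrier B" for a b
    using colour_autsD(3)[OF f, of "(a, b)"] that by (auto simp: X_def mem_Times_iff)
  have fD: "D (f (a, b)) (f (a', b')) = D (a, b) (a', b')"
    if "a \<in> carrier A" "b \<in> carrier B" "a' \<in> carrier A" "b' \<in> carrier B" for a b a' b'
    using colour_autsD(4)[OF f, of "(a, b)" "(a', b')"] that by (simp add: X_def)
  have fibre: "fst (f (a, b)) = fst (f (a, \<one>\<^bsub>B\<^esub>))" "snd (f (a, b)) = \<beta> a \<otimes>\<^bsub>B\<^esub> b"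
    if a: "a \<in> carrier A" and b: "b \<in> carrier B" for a b
  proof -
    have *: "D (f (a, \<one>\<^bsub>B\<^esub>)) (f (a, b)) = Inr b"
      using fD[OF a B.one_closed a b] b by (simp add: D_def)
    then show "fst (f (a, b)) = fst (f (a, \<one>\<^bsub>B\<^esub>))" by (auto simp: D_def split: if_splits)
    have "inv\<^bsub>B\<^esub> (\<beta> a) \<otimes>\<^bsub>B\<^esub> snd (f (a, b)) = b"
      using * by (auto simp: D_def \<beta>_def split: if_splits)
    then show "snd (f (a, b)) = \<beta> a \<otimes>\<^bsub>B\<^esub> b"
      using B.inv_solve_left[of b "\<beta> a" "snd (f (a, b))"] fX[OF a] b by (auto simp: \<beta>_def)
  qed
  have base: "fst (f (a, \<one>\<^bsub>B\<^esub>)) = \<alpha> \<otimes>\<^bsub>A\<^esub> a" if a: "a \<in> carrier A" for a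
  proof (cases "a = \<one>\<^bsub>A\<^esub>")
    case True
    then show ?thesis using fX(1)[of "\<one>\<^bsub>A\<^esub>" "\<one>\<^bsub>B\<^esub>"] by (simp add: \<alpha>_def)
  next
    case False
    then have "D (f (\<one>\<^bsub>A\<^esub>, \<one>\<^bsub>B\<^esub>)) (f (a, \<one>\<^bsub>B\<^esub>)) = Inl a"
      using fD[OF A.one_closed B.one_closed a B.one_closed] a by (simp add: D_def)
    then have "inv\<^bsub>A\<^esub> \<alpha> \<otimes>\<^bsub>A\<^esub> fst (f (a, \<one>\<^bsub>B\<^esub>)) = a"
      by (auto simp: D_def \<alpha>_def split: if_splits)
    then show ?thesis
      using A.inv_solve_left[of a \<alpha> "fst (f (a, \<one>\<^bsub>B\<^esub>))"] fX(1) a by (auto simp: \<alpha>_def)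
  qed
  have f_eq: "f (a, b) = (\<alpha> \<otimes>\<^bsub>A\<^esub> a, \<beta> a \<otimes>\<^bsub>B\<^esub> b)" if "a \<in> carrier A" "b \<in> carrier B" for a b
    using fibre[OF that] base[OF that(1)] by (simp add: prod_eq_iff)
  show ?thesis
  proof (rule that)
    show "\<alpha> \<in> carrier A" using fX(1) by (simp add: \<alpha>_def)
    show \<beta>: "\<beta> a \<in> carrier B" if "a \<in> carrier A" for a using fX(2) that by (simp add: \<beta>_def)
    show "f = act \<alpha> \<beta>"
      by (rule extensionalityI[OF colour_autsD(1)[OF f]]) (auto simp: act_def X_def f_eq)
    show "\<alpha> \<otimes>\<^bsub>A\<^esub> a \<in> Q \<and> \<beta> a = \<one>\<^bsub>B\<^esub> \<longleftrightarrow> a \<in> Q" if a: "a \<in> carrier A" for a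
      using colour_autsD(4)[OF f, of "(a, \<one>\<^bsub>B\<^esub>)" "(a, \<one>\<^bsub>B\<^esub>)"] a \<beta>[OF a]
      by (simp add: X_def f_eq)
  qed
qed

lemma act_inject:
  assumes "act \<alpha> \<beta> = act \<alpha>' \<beta>'"
    and "\<alpha> \<in> carrier A" "\<alpha>' \<in> carrier A" "\<beta> \<one>\<^bsub>A\<^esub> \<in> carrier B" "\<beta>' \<one>\<^bsub>A\<^esub> \<in> carrier B"
  shows "\<alpha> = \<alpha>'" "\<beta> \<one>\<^bsub>A\<^esub> = \<beta>' \<one>\<^bsub>A\<^esub>"
  using fun_cong[OF assms(1), of "(\<one>\<^bsub>A\<^esub>, \<one>\<^bsub>B\<^esub>)"] assms(2-) by (auto simp: act_def X_def)

lemma iso_all_marked: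
  "A \<cong> colour_group X (\<lambda>x y. (D x y, x \<in> marked (carrier A)))"
proof (rule iso_colour_groupI)
  let ?\<phi> = "\<lambda>g. act g (\<lambda>_. \<one>\<^bsub>B\<^esub>)"
  show "?\<phi> g \<in> marked_auts (carrier A)" if "g \<in> carrier A" for g
    using that by (intro act_mem_marked_auts) auto
  show "?\<phi> (g \<otimes>\<^bsub>A\<^esub> h) = compose X (?\<phi> g) (?\<phi> h)" if "g \<in> carrier A" "h \<in> carrier A" for g h
    using that by (simp add: compose_act)
  show "inj_on ?\<phi> (carrier A)"
    by (rule inj_onI) (erule act_inject, auto)
  show "f \<in> ?\<phi> ` carrier A" if f_aut: "f \<in> marked_auts (carrier A)" for f
  proof -
    obtain \<alpha> \<beta> where *: "\<alpha> \<in> carrier A" "\<And>a. a \<in> carrier A \<Longrightarrow> \<beta> a \<in> carrier B" "f = act \<alpha> \<beta>"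
      "\<And>a. a \<in> carrier A \<Longrightarrow> \<alpha> \<otimes>\<^bsub>A\<^esub> a \<in> carrier A \<and> \<beta> a = \<one>\<^bsub>B\<^esub> \<longleftrightarrow> a \<in> carrier A"
      by (rule marked_aut_is_act[OF f_aut]) blast
    have "f = ?\<phi> \<alpha>"
      unfolding *(3) using *(4) by (intro act_cong) auto
    with *(1) show ?thesis by blast
  qed
qed

lemma iso_one_unmarked:
  "B \<cong> colour_group X (\<lambda>x y. (D x y, x \<in> marked (carrier A - {\<one>\<^bsub>A\<^esub>})))"
proof (rule iso_colour_groupI)
  let ?Q = "carrier A - {\<one>\<^bsub>A\<^esub>}"
  let ?\<phi> = "\<lambda>g. act \<one>\<^bsub>A\<^esub> (\<lambda>a. if a = \<one>\<^bsub>A\<^esub> then g else \<one>\<^bsub>B\<^esub>)"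
  show "?\<phi> g \<in> marked_auts ?Q" if "g \<in> carrier B" for g
    using that by (intro act_mem_marked_auts) auto
  show "?\<phi> (g \<otimes>\<^bsub>B\<^esub> h) = compose X (?\<phi> g) (?\<phi> h)" if "g \<in> carrier B" "h \<in> carrier B" for g h
    using that by (subst compose_act) (auto intro: act_cong)
  show "inj_on ?\<phi> (carrier B)"
  proof (rule inj_onI)
    fix g h assume "g \<in> carrier B" "h \<in> carrier B" "?\<phi> g = ?\<phi> h"
    then show "g = h" using act_inject(2)[of "\<one>\<^bsub>A\<^esub>" "\<lambda>a. if a = \<one>\<^bsub>A\<^esub> then g else \<one>\<^bsub>B\<^esub>"
        "\<one>\<^bsub>A\<^esub>" "\<lambda>a. if a = \<one>\<^bsub>A\<^esub> then h else \<one>\<^bsub>B\<^esub>"] by simp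
  qed
  show "f \<in> ?\<phi> ` carrier B" if f_aut: "f \<in> marked_auts ?Q" for f
  proof -
    obtain \<alpha> \<beta> where \<alpha>: "\<alpha> \<in> carrier A" and \<beta>: "\<And>a. a \<in> carrier A \<Longrightarrow> \<beta> a \<in> carrier B"
      and f: "f = act \<alpha> \<beta>"
      and Q: "\<And>a. a \<in> carrier A \<Longrightarrow> \<alpha> \<otimes>\<^bsub>A\<^esub> a \<in> ?Q \<and> \<beta> a = \<one>\<^bsub>B\<^esub> \<longleftrightarrow> a \<in> ?Q"
      by (rule marked_aut_is_act[OF f_aut]) blast
    \<comment> \<open>The fibre over \<open>\<alpha>\<^sup>-\<^sup>1\<close> is sent to the unmarked fibre, so it is itself unmarked.\<close>
    have "inv\<^bsub>A\<^esub> \<alpha> = \<one>\<^bsub>A\<^esub>"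
      using Q[of "inv\<^bsub>A\<^esub> \<alpha>"] \<alpha> by auto
    then have 1: "\<alpha> = \<one>\<^bsub>A\<^esub>" using \<alpha> by (metis A.inv_inv A.inv_one)
    have "f = ?\<phi> (\<beta> \<one>\<^bsub>A\<^esub>)"
      unfolding f using 1 Q by (intro act_cong) auto
    then show ?thesis using \<beta> by blast
  qed
qed

lemma deletes_to: "deletes_to A B"
proof -
  let ?C = "(\<lambda>(x, y). D x y) ` (X \<times> X)"
  have "finite ?C" using finX by simp
  then obtain g :: "'a + 'b \<Rightarrow> nat" and m where g: "inj_on g ?C" "g ` ?C = {i. i < m}"
    using finite_imp_inj_to_nat_seg by metis
  \<comment> \<open>Number the colours, with \<open>2\<close> for the diagonal and numbers from \<open>3\<close> on for the others;
    \<open>n\<close> exceeds all of them, which also leaves room for the condition \<open>3 \<le> n\<close>.\<close>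
  define d where "d x y = (if x = y then 2 else 3 + g (D x y))" for x y
  define n where "n = 3 + m"
  define P where "P = marked (carrier A)"
  define v where "v = (\<one>\<^bsub>A\<^esub>, \<one>\<^bsub>B\<^esub>)"
  have one: "v \<in> X" "v \<in> P" "P \<subseteq> X" by (auto simp: v_def X_def P_def)
  have d_eq: "d x y = d x' y' \<longleftrightarrow> D x y = D x' y'"
    if "x \<in> X" "y \<in> X" "x' \<in> X" "y' \<in> X" for x y x' y'
  proof -
    have "D x y \<in> ?C" "D x' y' \<in> ?C" using that by auto
    then have "g (D x y) = g (D x' y') \<longleftrightarrow> D x y = D x' y'" using g(1) by (simp add: inj_on_eq_iff)
    then show ?thesis using D_diag[of x y] D_diag[of x' y'] that by (auto simp: d_def)
  qed
  have d_range: "d x y \<in> {2..n}" if "x \<in> X" "y \<in> X" for x y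
  proof -
    have "g (D x y) \<in> {i. i < m}" unfolding g(2)[symmetric] using that by auto
    then show ?thesis by (auto simp: d_def n_def)
  qed
  have enc: "encoding X R d n" if "R \<subseteq> P" for R
    using that one finX d_range by unfold_locales (auto simp: d_def n_def)
  have relabel: "colour_auts X (\<lambda>x y. (D x y, x \<in> R)) = colour_auts X (\<lambda>x y. (d x y, x \<in> R))" for R
  proof -
    have "(D (f x) (f y) = D x y) = (d (f x) (f y) = d x y)"
      if "f \<in> Bij X" "x \<in> X" "y \<in> X" for f x y
      using that d_eq Bij_imp_funcset[OF that(1)] by (simp add: Pi_iff)
    then show ?thesis unfolding colour_auts_def prod.inject by (intro Collect_cong) blast
  qed
  have P': "P - {v} = marked (carrier A - {\<one>\<^bsub>A\<^esub>})" by (auto simp: P_def v_def)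
  have V': "code_verts n X P - {Point 0 v} = code_verts n X (P - {v})"
    by (auto simp: code_verts_def)
  show ?thesis
  proof (rule deletes_toI)
    show "finite (code_verts n X P)" by (rule finite_code_verts[OF finX])
    have "card (Rung ` {..n + 1} :: ('a \<times> 'b) vertex set) = n + 2"
      by (simp add: card_image inj_on_def)
    moreover have "Rung ` {..n + 1} \<subseteq> code_verts n X P" by auto
    ultimately show "3 \<le> card (code_verts n X P)"
      using card_mono[OF finite_code_verts[OF finX], of "Rung ` {..n + 1}" n P]
      by (simp add: n_def)
    show "Point 0 v \<in> code_verts n X P" using one by simp
    show "adj d y x" if "adj d x y" for x y using that by (rule adj_sym)
    show "\<not> adj d x x" for x by (rule adj_irrefl)
    show "group A" "group B" by unfold_locales
    show "A \<cong> colour_group (code_verts n X P) (adj d)"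
      using iso_trans[OF iso_all_marked] encoding.colour_group_iso_code_group[OF enc[of P]]
      by (simp add: colour_group_def relabel P_def)
    show "B \<cong> colour_group (code_verts n X P - {Point 0 v}) (adj d)"
      using iso_trans[OF iso_one_unmarked] encoding.colour_group_iso_code_group[OF enc[OF Diff_subset, of "{v}"]]
      by (simp add: colour_group_def relabel P' V')
  qed
qed

end

theorem theorem4p1:
  fixes \<Gamma>\<^sub>1 :: "('a, 'c) monoid_scheme" and \<Gamma>\<^sub>2 :: "('b, 'd) monoid_scheme"
  assumes "group \<Gamma>\<^sub>1" and "finite (carrier \<Gamma>\<^sub>1)"
    and "group \<Gamma>\<^sub>2" and "finite (carrier \<Gamma>\<^sub>2)"
  shows "deletes_to \<Gamma>\<^sub>1 \<Gamma>\<^sub>2"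
proof -
  interpret group_pair \<Gamma>\<^sub>1 \<Gamma>\<^sub>2
    using assms by (intro group_pair.intro group_pair_axioms.intro)
  show ?thesis by (rule deletes_to)
qed

end
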